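(* Let $q$ be a prime power, let $g_1,g_2,\dots,g_k\in\mathbb{F}_q[x]$ be pairwise relatively prime polynomials, each of degree at least $1$, and let $f=g_1g_2\cdots g_k$. Then $\mathrm{Ord}(f)=\mathrm{lcm}\{\mathrm{Ord}(g_1),\mathrm{Ord}(g_2),\dots,\mathrm{Ord}(g_k)\}$.
   Context: For $h(x)=\sum_i a_i x^i\in\mathbb{F}_q[x]$, write $h\circ x=\sum_i a_i x^{q^i}\in\mathbb{F}_q[x]$ (the linearized $q$-associate of $h$). For $f\in\mathbb{F}_q[x]$ of degree at least $1$, the $\mathbb{F}_q$-Order $\mathrm{Ord}(f)$ is the monic polynomial $h\in\mathbb{F}_q[x]$ of least degree such that $f\mid h\circ x$ in $\mathbb{F}_q[x]$. The lcm is the monic least common multiple in $\mathbb{F}_q[x]$. *)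

theory Defs
  imports
    "HOL-Computational_Algebra.Computational_Algebra"
    "HOL-Library.Cardinality"
begin

(* A finite field F_q is a type 'a of class finite_field, with q = CARD('a). *)

definition q_associate :: "'a :: finite_field poly \<Rightarrow> 'a poly" where
  "q_associate h = (\<Sum>i\<le>degree h. monom (coeff h i) (CARD('a) ^ i))"

(* Such an h exists and is unique when degree f \<ge> 1; Ord f is unspecified for f = 0. *)
definition Ord :: "'a :: finite_field poly \<Rightarrow> 'a poly" where
  "Ord f = (THE h. is_arg_min degree (\<lambda>h. lead_coeff h = 1 \<and> f dvd q_associate h) h)"

(* The class field_gcd only supplies the operations behind Lcm and is no restriction on
   the field: every field carries such a structure, with unit_factor the identity. Hence
   the Lcm of polynomials over it is the monic least common multiple. *)
lemma lead_coeff_Lcm: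
  fixes A :: "'a :: field_gcd poly set"
  assumes "Lcm A \<noteq> 0"
  shows "lead_coeff (Lcm A) = 1"
proof -
  have "lead_coeff (Lcm A) \<noteq> 0"
    using assms by simp
  then have "is_unit (lead_coeff (Lcm A))"
    by (simp add: dvd_field_iff)
  moreover have "unit_factor (Lcm A) = 1"
    using assms by (simp add: unit_factor_Lcm)
  ultimately show ?thesis
    by (simp add: unit_factor_poly_def is_unit_unit_factor one_pCons)
qed

end

(* The polynomials h with f dvd q_associate h form a nonzero ideal of F_q[x]: multiplying h
   by x raises its q-associate to the q-th power.  Hence Ord f is the monic generator of this
   ideal.  For pairwise coprime g_i, a polynomial is divisible by their product iff it is
   divisible by each g_i, so the ideal of the product is the intersection of the ideals of the
   g_i, and its generator is the lcm of their generators. *)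
theory Submission
  imports Defs
begin

section \<open>Additivity of the \<open>q\<close>-th power on polynomials\<close>

text \<open>The polynomial \<open>(X + 1)^q - X^q - 1\<close> has degree below \<open>q\<close> but vanishes on all of the
  field, so its coefficients are zero. This avoids showing that \<open>q\<close> is a power of the
  characteristic.\<close>
lemma of_nat_card_choose_eq_0:
  assumes "0 < j" "j < CARD('a :: finite_field)"
  shows "(of_nat (CARD('a) choose j) :: 'a) = 0"
proof -
  define q where "q = CARD('a)"
  define c :: "nat \<Rightarrow> 'a" where "c k = of_nat (q choose k)" for k
  define P :: "'a poly" where "P = (\<Sum>k\<in>{0<..<q}. monom (c k) k)"
  have q: "q > 0"
    unfolding q_def by simp
  have pow: "(a :: 'a) ^ q = a" for a
    unfolding q_def by (rule finite_field_power_card_eq_same)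
  have root: "poly P a = 0" for a
  proof -
    \<comment> \<open>This expands \<open>(a + 1)^q\<close>, which equals \<open>a + 1\<close> in
      the field; the end terms of the expansion are \<open>1\<close> and \<open>a\<close>.\<close>
    have "a + 1 = (\<Sum>k\<le>q. c k * a ^ k)"
      using binomial_ring[of a 1 q] by (simp add: pow c_def)
    also have "{..q} = insert 0 (insert q {0<..<q})"
      using q by auto
    also have "(\<Sum>k\<in>\<dots>. c k * a ^ k) = 1 + (a + poly P a)"
      using q by (simp add: P_def poly_sum poly_monom pow c_def)
    finally show ?thesis
      by simp
  qed
  have "P = 0"
  proof (rule ccontr)
    assume "P \<noteq> 0"
    have "degree P \<le> q - 1"
      unfolding P_def by (intro degree_sum_le) (auto intro: order_trans[OF degree_monom_le])
    moreover have "card {x. poly P x = 0} \<le> degree P"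
      by (rule card_poly_roots_bound) fact
    ultimately show False
      using q by (simp add: root flip: q_def)
  qed
  moreover have "coeff P j = c j"
    using assms by (simp add: P_def coeff_sum q_def)
  ultimately show ?thesis
    by (simp add: c_def q_def)
qed

text \<open>The inner binomial coefficients vanish already in the field, so only the two end terms
  of the expansion survive.\<close>

lemma add_poly_power_card:
  fixes x y :: "'a :: finite_field poly"
  shows "(x + y) ^ CARD('a) = x ^ CARD('a) + y ^ CARD('a)"
proof -
  define q where "q = CARD('a)"
  have q: "q > 0"
    unfolding q_def by simp
  have *: "(of_nat (q choose k) :: 'a poly) = 0" if "k \<in> {0<..<q}" for k
    using of_nat_card_choose_eq_0[where ?'a = 'a, of k] that by (simp add: q_def of_nat_poly)
  have "(x + y) ^ q = (\<Sum>k\<le>q. of_nat (q choose k) * x ^ k * y ^ (q - k))"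
    by (rule binomial_ring)
  also have "{..q} = insert 0 (insert q {0<..<q})"
    using q by auto
  also have "(\<Sum>k\<in>\<dots>. of_nat (q choose k) * x ^ k * y ^ (q - k)) = x ^ q + y ^ q"
    using q by (simp add: *)
  finally show ?thesis
    by (simp add: q_def)
qed

lemma sum_poly_power_card:
  fixes p :: "'b \<Rightarrow> 'a :: finite_field poly"
  shows "(\<Sum>i\<in>A. p i) ^ CARD('a) = (\<Sum>i\<in>A. p i ^ CARD('a))"
  by (induction A rule: infinite_finite_induct) (simp_all add: add_poly_power_card power_0_left)

section \<open>Algebra of q-associates\<close>

lemma q_associate_eq_sum:
  fixes h :: "'a :: finite_field poly"
  assumes "degree h \<le> n"
  shows "q_associate h = (\<Sum>i\<le>n. monom (coeff h i) (CARD('a) ^ i))"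
  unfolding q_associate_def
  by (rule sum.mono_neutral_left) (use assms in \<open>auto simp: coeff_eq_0\<close>)

lemma q_associate_0 [simp]: "q_associate 0 = 0"
  by (simp add: q_associate_def)

lemma q_associate_add: "q_associate (g + h) = q_associate g + q_associate h"
proof -
  \<comment> \<open>A sum can have smaller degree than its summands, so all three associates are
    expanded up to one common bound.\<close>
  define n where "n = max (degree g) (degree h)"
  have "degree g \<le> n" "degree h \<le> n" "degree (g + h) \<le> n"
    by (auto simp: n_def degree_add_le_max)
  then show ?thesis
    by (simp add: q_associate_eq_sum[of _ n] add_monom[symmetric] sum.distrib)
qed

lemma q_associate_smult: "q_associate (smult c h) = smult c (q_associate h)"
proof -
  have "smult c (\<Sum>i\<in>A. p i) = (\<Sum>i\<in>A. smult c (p i))" for A and p :: "nat \<Rightarrow> 'a poly"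
    by (induction A rule: infinite_finite_induct) (simp_all add: smult_add_right)
  then show ?thesis
    by (simp add: q_associate_eq_sum[of _ "degree h"] smult_monom)
qed

lemma q_associate_diff: "q_associate (g - h) = q_associate g - q_associate h"
  using q_associate_add[of g "- h"] q_associate_smult[of "- 1" h] by simp

text \<open>Additivity moves the \<open>q\<close>-th power onto the single terms. Since
  \<open>a^q = a\<close> for every coefficient, \<open>a x^(q^i)\<close> becomes
  \<open>a x^(q^(i+1))\<close>: the coefficients shift by one place.\<close>

lemma q_associate_pCons_0:
  fixes h :: "'a :: finite_field poly"
  shows "q_associate (pCons 0 h) = q_associate h ^ CARD('a)"
proof -
  have "q_associate (pCons 0 h) =
      (\<Sum>i\<le>Suc (degree h). monom (coeff (pCons 0 h) i) (CARD('a) ^ i))"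
    by (rule q_associate_eq_sum) (rule degree_pCons_le)
  also have "\<dots> = (\<Sum>i\<le>degree h. monom (coeff h i) (CARD('a) ^ i) ^ CARD('a))"
    by (simp add: sum.atMost_Suc_shift monom_power finite_field_power_card_eq_same mult.commute
        del: sum.atMost_Suc)
  also have "\<dots> = q_associate h ^ CARD('a)"
    by (simp add: q_associate_def sum_poly_power_card)
  finally show ?thesis .
qed

text \<open>Horner's scheme \<open>pCons a p * h = smult a h + pCons 0 (p * h)\<close> drives the
  induction: the associate of the last summand is the \<open>q\<close>-th power of a multiple of
  \<open>f\<close>.\<close>

lemma dvd_q_associate_mult:
  assumes "f dvd q_associate h"
  shows "f dvd q_associate (p * h)"
proof (induction p)
  case (pCons a p)
  have "f dvd q_associate (pCons 0 (p * h))"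
    unfolding q_associate_pCons_0 by (rule dvd_trans[OF pCons.IH dvd_power]) simp
  then show ?case
    using assms by (simp add: q_associate_add q_associate_smult dvd_smult)
qed simp

section \<open>Existence of the Order\<close>

lemma finite_poly_degree_le: "finite {p :: 'a :: {finite, zero} poly. degree p \<le> n}"
proof (rule finite_subset)
  show "{p :: 'a poly. degree p \<le> n} \<subseteq> Poly ` {xs. set xs \<subseteq> UNIV \<and> length xs \<le> Suc n}"
  proof
    fix p :: "'a poly"
    assume "p \<in> {p. degree p \<le> n}"
    then have "length (coeffs p) \<le> Suc n"
      by (cases "p = 0") (simp_all add: length_coeffs_degree)
    then show "p \<in> Poly ` {xs. set xs \<subseteq> UNIV \<and> length xs \<le> Suc n}"
      by (intro image_eqI[of _ _ "coeffs p"]) simp_all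
  qed
  show "finite (Poly ` {xs :: 'a list. set xs \<subseteq> UNIV \<and> length xs \<le> Suc n})"
    by (intro finite_imageI finite_lists_length_le) simp
qed

text \<open>By pigeonhole, two of the polynomials \<open>x^(q^i)\<close> agree modulo \<open>f\<close>.\<close>
lemma ex_nonzero_dvd_q_associate:
  fixes f :: "'a :: finite_field poly"
  assumes "f \<noteq> 0"
  shows "\<exists>h. h \<noteq> 0 \<and> f dvd q_associate h"
proof -
  define r where "r i = q_associate (monom (1 :: 'a) i) mod f" for i
  \<comment> \<open>The bound is weak to cover the zero remainder for constant
    \<open>f\<close>.\<close>
  have "degree (r i) \<le> degree f" for i
    using degree_mod_less[OF assms, of "q_associate (monom 1 i)"] by (auto simp: r_def)
  then have "range r \<subseteq> {p. degree p \<le> degree f}"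
    by auto
  then have "finite (range r)"
    by (rule finite_subset) (rule finite_poly_degree_le)
  then have "\<not> inj r"
    using finite_imageD[of r UNIV] by auto
  then obtain i j where ij: "i \<noteq> j" "r i = r j"
    by (auto simp: inj_def)
  let ?h = "monom (1 :: 'a) i - monom 1 j"
  have "f dvd q_associate ?h"
    using ij by (simp add: q_associate_diff mod_eq_dvd_iff r_def)
  moreover have "coeff ?h i \<noteq> 0"
    using ij by simp
  then have "?h \<noteq> 0"
    by (metis coeff_0)
  ultimately show ?thesis
    by blast
qed

section \<open>The Order as monic generator of an ideal\<close>

lemma monic_poly_dvd_antisym:
  fixes p q :: "'a :: idom poly"
  assumes "p dvd q" "q dvd p" "lead_coeff p = 1" "lead_coeff q = 1"
  shows "p = q"
proof -
  obtain c where c: "q = p * c"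
    using assms(1) by (auto elim: dvdE)
  have nz: "p \<noteq> 0" "q \<noteq> 0"
    using assms(3,4) by auto
  then have "degree q \<le> degree p"
    using assms(2) by (simp add: dvd_imp_degree_le)
  then have "degree c = 0"
    using nz by (auto simp: c degree_mult_eq)
  moreover have "lead_coeff c = 1"
    using assms(3,4) by (simp add: c lead_coeff_mult)
  ultimately show ?thesis
    by (auto simp: c elim: degree_eq_zeroE)
qed

text \<open>Division with remainder: a nonzero remainder modulo a monic element of least degree
  would, once rescaled to be monic, be a smaller candidate.\<close>

lemma
  fixes f :: "'a :: finite_field poly"
  assumes "f \<noteq> 0"
  shows lead_coeff_Ord: "lead_coeff (Ord f) = 1"
    and Ord_dvd_iff: "Ord f dvd h \<longleftrightarrow> f dvd q_associate h"
proof -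
  define I where "I = (\<lambda>h. lead_coeff h = 1 \<and> f dvd q_associate h)"
  have I_normalize: "I (smult (inverse (lead_coeff h)) h)" if "h \<noteq> 0" "f dvd q_associate h" for h
    using that by (simp add: I_def q_associate_smult dvd_smult)
  obtain h0 where "h0 \<noteq> 0" "f dvd q_associate h0"
    using ex_nonzero_dvd_q_associate[OF assms] by blast
  then have "\<exists>h. I h"
    using I_normalize by blast
  then obtain d where d: "is_arg_min degree I d"
    using ex_has_least_nat[of I _ degree] by (auto simp: is_arg_min_linorder)
  \<comment> \<open>This is stated for every minimiser, not only \<open>d\<close>: two minimisers
    then divide each other, which gives the uniqueness that \<open>THE\<close> requires.\<close>
  have gen: "e dvd h" if e: "is_arg_min degree I e" and h: "f dvd q_associate h" for e h
  proof (rule ccontr)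
    assume "\<not> e dvd h"
    then have nz: "h mod e \<noteq> 0"
      by (simp add: mod_eq_0_iff_dvd)
    have "I e"
      using e by (simp add: is_arg_min_def)
    then have "e \<noteq> 0" and "f dvd q_associate (h div e * e)"
      by (auto simp: I_def intro: dvd_q_associate_mult)
    then have "f dvd q_associate (h mod e)"
      using h unfolding minus_div_mult_eq_mod[symmetric] q_associate_diff by (intro dvd_diff)
    then have "I (smult (inverse (lead_coeff (h mod e))) (h mod e))"
      using I_normalize nz by blast
    moreover have "degree (h mod e) < degree e"
      using degree_mod_less[OF \<open>e \<noteq> 0\<close>, of h] nz by simp
    ultimately show False
      using e nz by (auto simp: is_arg_min_def)
  qed
  have I: "I e" if "is_arg_min degree I e" for e
    using that by (simp add: is_arg_min_def)
  have "Ord f = d"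
    unfolding Ord_def I_def[symmetric]
  proof (rule the_equality)
    show "is_arg_min degree I d"
      by (rule d)
    fix e assume e: "is_arg_min degree I e"
    show "e = d"
      using gen[OF d] gen[OF e] I[OF d] I[OF e]
      by (intro monic_poly_dvd_antisym) (auto simp: I_def)
  qed
  then show "lead_coeff (Ord f) = 1"
    using I[OF d] by (simp add: I_def)
  show "Ord f dvd h \<longleftrightarrow> f dvd q_associate h"
  proof
    assume "Ord f dvd h"
    then obtain c where "h = c * d"
      by (metis \<open>Ord f = d\<close> dvdE mult.commute)
    then show "f dvd q_associate h"
      using I[OF d] by (simp add: I_def dvd_q_associate_mult)
  next
    assume "f dvd q_associate h"
    then show "Ord f dvd h"
      using gen[OF d] by (simp add: \<open>Ord f = d\<close>)
  qed
qed

section \<open>Coprime products and least common multiples\<close>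

lemma prod_coprime_dvd_iff:
  fixes g :: "'b \<Rightarrow> 'a :: semiring_gcd"
  assumes "finite A"
    and "\<And>i j. i \<in> A \<Longrightarrow> j \<in> A \<Longrightarrow> i \<noteq> j \<Longrightarrow> coprime (g i) (g j)"
  shows "prod g A dvd p \<longleftrightarrow> (\<forall>i\<in>A. g i dvd p)"
  using assms
proof (induction A rule: finite_induct)
  case (insert i A)
  have "coprime (g i) (prod g A)"
    using insert.prems insert.hyps by (intro prod_coprime_right) auto
  then have "g i * prod g A dvd p \<longleftrightarrow> g i dvd p \<and> prod g A dvd p"
    by (auto intro: divides_mult dvd_mult_left dvd_mult_right)
  then show ?case
    using insert by simp
qed simp

theorem proposition9:
  fixes g :: "nat \<Rightarrow> 'a :: {finite_field, field_gcd} poly"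
    and f :: "'a poly" and k :: nat
  assumes "k \<ge> 1"
    and "\<And>i. i \<in> {1..k} \<Longrightarrow> degree (g i) \<ge> 1"
    and "\<And>i j. i \<in> {1..k} \<Longrightarrow> j \<in> {1..k} \<Longrightarrow> i \<noteq> j \<Longrightarrow> coprime (g i) (g j)"
    and "f = (\<Prod>i = 1..k. g i)"
  shows "Ord f = (LCM i\<in>{1..k}. Ord (g i))"
proof -
  let ?L = "LCM i\<in>{1..k}. Ord (g i)"
  have g: "g i \<noteq> 0" if "i \<in> {1..k}" for i
    using assms(2)[OF that] by auto
  then have f: "f \<noteq> 0"
    by (simp add: assms(4))
  have "Ord f dvd h \<longleftrightarrow> (\<forall>i\<in>{1..k}. Ord (g i) dvd h)" for h
    using prod_coprime_dvd_iff[of "{1..k}" g "q_associate h"] assms(3) g f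
    by (simp add: Ord_dvd_iff assms(4))
  then have iff: "Ord f dvd h \<longleftrightarrow> ?L dvd h" for h
    by (simp add: Lcm_dvd_iff)
  have monic: "lead_coeff (Ord f) = 1"
    using f by (rule lead_coeff_Ord)
  \<comment> \<open>\<open>?L\<close> divides the monic, hence nonzero,
    \<open>Ord f\<close>.\<close>
  have "?L \<noteq> 0"
    using iff[of "Ord f"] monic by auto
  then have "lead_coeff ?L = 1"
    by (rule lead_coeff_Lcm)
  then show ?thesis
    \<comment> \<open>Having the same multiples, the two polynomials divide each other.\<close>
    using iff[of "Ord f"] iff[of ?L] monic by (intro monic_poly_dvd_antisym) auto
qed

end
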